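(* Suppose $Q$ is decomposed as $Q=\sum_{i=1}^KL_iL_i^\top+\mathrm{diag}(\delta)+N$ with $\delta\ge0$ and $N\succcurlyeq0$, and let $R=\sum_{i=1}^KL_iL_i^\top+N$. Then at any binary point $x\in X$ one has $\bar f_{\mathrm{persp}}(x)=\bar f_{\mathrm{persp+ro}}(x)$. Moreover, for any two vectors $t$ and $\tilde t$ returned at $x$ by the procedures $\mathrm{CUT}_{\mathrm{persp}}$ and $\mathrm{CUT}_{\mathrm{persp+ro}}$ (described in the context), respectively, one always has $\sum_{i\in S^C}\tilde t_i\ge\sum_{i\in S^C}t_i$, where $S^C=\{i:x_i=0\}$.
   Context: Problem data: $Q\in\mathbb{R}^{n\times n}$ positive definite, $g,h\in\mathbb{R}^n$, $A\in\mathbb{R}^{m_1\times n}$, $b\in\mathbb{R}^{m_1}$, $C,D\in\mathbb{R}^{m_2\times n}$, $X\subseteq\{0,1\}^n$. Standing assumption: there exists $(\tilde x,\tilde y)$ with $\tilde x\in X$, $A\tilde y\le b$, $C\tilde y\le D\tilde x$, $\tilde y_i(1-\tilde x_i)=0$ for all $i$. $L_i\in\mathbb{R}^n$ is the $i$th column of $L\in\mathbb{R}^{n\times K}$, $1\le K\le n$. Conventions: quotients $a^2/s$ are the closed perspective function: $a^2/s$ if $s>0$, $0$ if $a=s=0$, $+\infty$ otherwise. $F_1=\{y:Ay\le b\}$, $F_2=\{(x,y):Cy\le Dx\}$; $\mathcal I_{\mathcal C}$ is the indicator function of $\mathcal C$ ($0$ on $\mathcal C$, $+\infty$ off it). Define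 $$f_{\mathrm{persp}}(x,y)=y^\top Ry+\sum_{i=1}^n\delta_i\frac{y_i^2}{x_i}+g^\top y+h^\top x+\mathcal I_{F_1}(y)+\mathcal I_{F_2}(x,y),$$ $$f_{\mathrm{persp+ro}}(x,y)=\sum_{i=1}^K\max\Big\{(L_i^\top y)^2,\frac{(L_i^\top y)^2}{\sum_{1\le j\le n,\,L_{ji}\ne0}x_j}\Big\}+y^\top Ny+\sum_{i=1}^n\delta_i\frac{y_i^2}{x_i}+g^\top y+h^\top x+\mathcal I_{F_1}(y)+\mathcal I_{F_2}(x,y),$$ and $\bar f(x)=\inf_{y\in\mathbb{R}^n}f(x,y)$ for each of the two functions. Notation: $H_i$ is the $i$th column of a matrix $H$; subscript $S$ on $A,C$ selects columns, on $R$ the principal submatrix, on vectors the subvector. Each of the two procedures, at $x$, begins as follows: let $S=\{i:x_i>0\}$, $S^C=[n]\setminus S$; set $y_i=0$ for $i\in S^C$ and let $(y_S,\lambda,\mu)$ be the optimal primal-dual solution of $$\min_{\tilde y\in\mathbb{R}^{|S|}}\ \tilde y^\top\big(R_S+\mathrm{diag}(\{\delta_i/x_i\}_{i\in S})\big)\tilde y+g_S^\top\tilde y\quad\text{s.t. }A_S\tilde y\le b,\ C_S\tilde y\le Dx,$$ with $\lambda,\mu$ the multipliers of the two groups of constraints. For $i\in S$ the returned component is $-\delta_iy_i^2/x_i^2-\mu^\top D_i+h_i$. For $i\in S^C$ put $r_i=-2\sum_{j\in S}R_{ij}y_j-g_i-\lambda^\top A_i-\mu^\top C_i$. $\mathrm{CUT}_{\mathrm{persp}}$: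 for $i\in S^C$, set $\Psi_i=\frac1{\delta_i}r_i$ and $t_i=-\frac{\delta_i}4\Psi_i^2-\mu^\top D_i+h_i$. $\mathrm{CUT}_{\mathrm{persp+ro}}$: let $I^0=\{i\in\{1,\dots,K\}:\sum_{1\le l\le n,\,L_{li}\ne0}x_l=0\}$ and $n_i=|\{j:L_{ji}\ne0\}|$ for $i\in I^0$; solve $\big(\mathrm{diag}(\{\delta_i\}_{i\in S^C})+\sum_{i\in I^0}\frac1{n_i}(L_i)_{S^C}(L_i)_{S^C}^\top\big)\beta=2r$; set $\Psi_i=\frac12\beta_i$ for $i\in S^C$, $\psi_i=\frac1{2n_i}\sum_{j\in S^C}L_{ji}\beta_j$ for $i\in I^0$, and $\tilde t_i=-\frac{\delta_i}4\Psi_i^2-\frac14\sum_{j\in I^0,\,L_{ij}\ne0}\psi_j^2-\mu^\top D_i+h_i$ for $i\in S^C$.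
   Formalization: Both procedures use the same optimal primal-dual solution (y,λ,μ), any one; with different multipliers the inequality can fail. If some δ_i=0 with i in S^C, CUT_persp returns a vector only if r_i=0 (Ψ_i is otherwise undefined). δ_i y_i²/x_i is +∞ at x_i=0≠y_i even if δ_i=0. *)

theory Defs
  imports "HOL-Analysis.Analysis"
begin

definition pos_semidef :: "real^'n^'n \<Rightarrow> bool" where
  "pos_semidef M \<longleftrightarrow> transpose M = M \<and> (\<forall>v. 0 \<le> v \<bullet> (M *v v))"

definition pos_def :: "real^'n^'n \<Rightarrow> bool" where
  "pos_def M \<longleftrightarrow> transpose M = M \<and> (\<forall>v. v \<noteq> 0 \<longrightarrow> 0 < v \<bullet> (M *v v))"

definition diag :: "real^'n \<Rightarrow> real^'n^'n" where
  "diag d = (\<chi> i j. if i = j then d $ i else 0)"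

definition outer :: "real^'n \<Rightarrow> real^'n \<Rightarrow> real^'n^'n" where
  "outer u v = (\<chi> i j. u $ i * v $ j)"

definition indicat :: "'a set \<Rightarrow> 'a \<Rightarrow> ereal" where
  "indicat S z = (if z \<in> S then 0 else \<infinity>)"

text \<open>
  The closed perspective convention for the quotient \<open>d * a\<^sup>2 / s\<close>. The coefficient \<open>d\<close> is kept
  inside because the quotient is \<open>\<infinity>\<close> off its domain also when \<open>d = 0\<close>, whereas \<open>0 * \<infinity> = 0\<close>
  holds in \<^typ>\<open>ereal\<close>. Thus \<open>x $ i = 0\<close> always forces \<open>y $ i = 0\<close> in the functions below.
\<close>

definition persp :: "real \<Rightarrow> real \<Rightarrow> real \<Rightarrow> ereal" where
  "persp d a s = (if s > 0 then ereal (d * (a\<^sup>2 / s)) else if a = 0 \<and> s = 0 then 0 else \<infinity>)"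

definition F1 :: "real^'n^'m1 \<Rightarrow> real^'m1 \<Rightarrow> (real^'n) set" where
  "F1 A b = {y. A *v y \<le> b}"

definition F2 :: "real^'n^'m2 \<Rightarrow> real^'n^'m2 \<Rightarrow> ((real^'n) \<times> (real^'n)) set" where
  "F2 C D = {(x, y). C *v y \<le> D *v x}"

definition f_persp ::
  "real^'n^'n \<Rightarrow> real^'n \<Rightarrow> real^'n \<Rightarrow> real^'n \<Rightarrow> real^'n^'m1 \<Rightarrow> real^'m1 \<Rightarrow>
   real^'n^'m2 \<Rightarrow> real^'n^'m2 \<Rightarrow> real^'n \<Rightarrow> real^'n \<Rightarrow> ereal" where
  "f_persp R \<delta> g h A b C D x y =
     ereal (y \<bullet> (R *v y)) + (\<Sum>i\<in>UNIV. persp (\<delta> $ i) (y $ i) (x $ i))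
     + ereal (g \<bullet> y) + ereal (h \<bullet> x) + indicat (F1 A b) y + indicat (F2 C D) (x, y)"

definition f_persp_ro ::
  "real^'k^'n \<Rightarrow> real^'n^'n \<Rightarrow> real^'n \<Rightarrow> real^'n \<Rightarrow> real^'n \<Rightarrow> real^'n^'m1 \<Rightarrow> real^'m1 \<Rightarrow>
   real^'n^'m2 \<Rightarrow> real^'n^'m2 \<Rightarrow> real^'n \<Rightarrow> real^'n \<Rightarrow> ereal" where
  "f_persp_ro L N \<delta> g h A b C D x y =
     (\<Sum>i\<in>UNIV. max (ereal ((column i L \<bullet> y)\<^sup>2))
                   (persp 1 (column i L \<bullet> y) (\<Sum>j | L $ j $ i \<noteq> 0. x $ j)))
     + ereal (y \<bullet> (N *v y)) + (\<Sum>i\<in>UNIV. persp (\<delta> $ i) (y $ i) (x $ i))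
     + ereal (g \<bullet> y) + ereal (h \<bullet> x) + indicat (F1 A b) y + indicat (F2 C D) (x, y)"

definition f_bar :: "(real^'n \<Rightarrow> real^'n \<Rightarrow> ereal) \<Rightarrow> real^'n \<Rightarrow> ereal" where
  "f_bar f x = (INF y. f x y)"

definition supp :: "real^'n \<Rightarrow> 'n set" where
  "supp x = {i. x $ i > 0}"

text \<open>
  The reduced problem over \<open>\<real>\<^sup>|\<^sup>S\<^sup>|\<close>, \<open>S = supp x\<close>: a vector indexed by \<open>S\<close> is represented by any
  vector of \<^typ>\<open>real^'n\<close> with these components on \<open>S\<close>, the others being ignored.
\<close>

definition red_obj :: "real^'n^'n \<Rightarrow> real^'n \<Rightarrow> real^'n \<Rightarrow> real^'n \<Rightarrow> real^'n \<Rightarrow> real" where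
  "red_obj R \<delta> g x z =
     (\<Sum>i\<in>supp x. \<Sum>j\<in>supp x. z $ i * (R $ i $ j + (if i = j then \<delta> $ i / x $ i else 0)) * z $ j)
     + (\<Sum>i\<in>supp x. g $ i * z $ i)"

definition mult_cols :: "real^'n^'m \<Rightarrow> 'n set \<Rightarrow> real^'n \<Rightarrow> real^'m" where
  "mult_cols M S z = (\<Sum>j\<in>S. z $ j *\<^sub>R column j M)"

definition red_feasible ::
  "real^'n^'m1 \<Rightarrow> real^'m1 \<Rightarrow> real^'n^'m2 \<Rightarrow> real^'n^'m2 \<Rightarrow> real^'n \<Rightarrow> real^'n \<Rightarrow> bool" where
  "red_feasible A b C D x z \<longleftrightarrow>
     mult_cols A (supp x) z \<le> b \<and> mult_cols C (supp x) z \<le> D *v x"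

definition red_lagrangian ::
  "real^'n^'n \<Rightarrow> real^'n \<Rightarrow> real^'n \<Rightarrow> real^'n^'m1 \<Rightarrow> real^'m1 \<Rightarrow> real^'n^'m2 \<Rightarrow> real^'n^'m2 \<Rightarrow>
   real^'n \<Rightarrow> real^'n \<Rightarrow> real^'m1 \<Rightarrow> real^'m2 \<Rightarrow> real" where
  "red_lagrangian R \<delta> g A b C D x z l \<mu> =
     red_obj R \<delta> g x z + l \<bullet> (mult_cols A (supp x) z - b)
     + \<mu> \<bullet> (mult_cols C (supp x) z - D *v x)"

definition red_dual ::
  "real^'n^'n \<Rightarrow> real^'n \<Rightarrow> real^'n \<Rightarrow> real^'n^'m1 \<Rightarrow> real^'m1 \<Rightarrow> real^'n^'m2 \<Rightarrow> real^'n^'m2 \<Rightarrow>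
   real^'n \<Rightarrow> real^'m1 \<Rightarrow> real^'m2 \<Rightarrow> ereal" where
  "red_dual R \<delta> g A b C D x l \<mu> = (INF z. ereal (red_lagrangian R \<delta> g A b C D x z l \<mu>))"

definition primal_dual_opt ::
  "real^'n^'n \<Rightarrow> real^'n \<Rightarrow> real^'n \<Rightarrow> real^'n^'m1 \<Rightarrow> real^'m1 \<Rightarrow> real^'n^'m2 \<Rightarrow> real^'n^'m2 \<Rightarrow>
   real^'n \<Rightarrow> real^'n \<Rightarrow> real^'m1 \<Rightarrow> real^'m2 \<Rightarrow> bool" where
  "primal_dual_opt R \<delta> g A b C D x y l \<mu> \<longleftrightarrow>
     (\<forall>i. i \<notin> supp x \<longrightarrow> y $ i = 0) \<and>
     red_feasible A b C D x y \<and>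
     (\<forall>z. red_feasible A b C D x z \<longrightarrow> red_obj R \<delta> g x y \<le> red_obj R \<delta> g x z) \<and>
     0 \<le> l \<and> 0 \<le> \<mu> \<and>
     (\<forall>l' \<mu>'. 0 \<le> l' \<longrightarrow> 0 \<le> \<mu>' \<longrightarrow>
        red_dual R \<delta> g A b C D x l' \<mu>' \<le> red_dual R \<delta> g A b C D x l \<mu>)"

definition cut_residual ::
  "real^'n^'n \<Rightarrow> real^'n \<Rightarrow> real^'n^'m1 \<Rightarrow> real^'n^'m2 \<Rightarrow>
   real^'n \<Rightarrow> real^'n \<Rightarrow> real^'m1 \<Rightarrow> real^'m2 \<Rightarrow> 'n \<Rightarrow> real" where
  "cut_residual R g A C x y l \<mu> i =
     - 2 * (\<Sum>j\<in>supp x. R $ i $ j * y $ j) - g $ i - l \<bullet> column i A - \<mu> \<bullet> column i C"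

text \<open>
  The procedures, as relations between the primal-dual solution \<open>(y, l, \<mu>)\<close> that they start from and
  the vectors returned. The quotient defining \<open>\<Psi>\<close> exists only for \<open>\<delta> $ i \<noteq> 0\<close>; the case \<open>0 / 0\<close> is
  also admitted (with value \<open>0\<close>, and \<open>\<Psi>\<close> then does not influence \<open>t\<close>), but for \<open>\<delta> $ i = 0\<close> and a
  nonzero residual nothing is returned.
\<close>

definition cut_persp ::
  "real^'n^'n \<Rightarrow> real^'n \<Rightarrow> real^'n \<Rightarrow> real^'n \<Rightarrow> real^'n^'m1 \<Rightarrow> real^'n^'m2 \<Rightarrow> real^'n^'m2 \<Rightarrow>
   real^'n \<Rightarrow> real^'n \<Rightarrow> real^'m1 \<Rightarrow> real^'m2 \<Rightarrow> real^'n \<Rightarrow> bool" where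
  "cut_persp R \<delta> g h A C D x y l \<mu> t \<longleftrightarrow>
     (\<forall>i\<in>supp x. t $ i = - \<delta> $ i * (y $ i)\<^sup>2 / (x $ i)\<^sup>2 - \<mu> \<bullet> column i D + h $ i) \<and>
     (\<exists>\<Psi> :: 'n \<Rightarrow> real. \<forall>i\<in>- supp x.
        (\<delta> $ i = 0 \<longrightarrow> cut_residual R g A C x y l \<mu> i = 0) \<and>
        \<Psi> i = 1 / \<delta> $ i * cut_residual R g A C x y l \<mu> i \<and>
        t $ i = - (\<delta> $ i / 4) * (\<Psi> i)\<^sup>2 - \<mu> \<bullet> column i D + h $ i)"

definition idx0 :: "real^'k^'n \<Rightarrow> real^'n \<Rightarrow> 'k set" where
  "idx0 L x = {i. (\<Sum>l | L $ l $ i \<noteq> 0. x $ l) = 0}"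

definition nnz :: "real^'k^'n \<Rightarrow> 'k \<Rightarrow> nat" where
  "nnz L i = card {j. L $ j $ i \<noteq> 0}"

text \<open>
  If \<open>column k L = 0\<close>, then \<open>nnz L k = 0\<close> and \<open>1 / nnz L k\<close> is \<open>0\<close> in HOL; it only multiplies zero
  entries of \<open>L\<close>, and \<open>\<psi> k\<close> does not occur in the returned vector.
\<close>

definition cut_persp_ro ::
  "real^'k^'n \<Rightarrow> real^'n^'n \<Rightarrow> real^'n \<Rightarrow> real^'n \<Rightarrow> real^'n \<Rightarrow> real^'n^'m1 \<Rightarrow> real^'n^'m2 \<Rightarrow>
   real^'n^'m2 \<Rightarrow> real^'n \<Rightarrow> real^'n \<Rightarrow> real^'m1 \<Rightarrow> real^'m2 \<Rightarrow> real^'n \<Rightarrow> bool" where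
  "cut_persp_ro L R \<delta> g h A C D x y l \<mu> t \<longleftrightarrow>
     (\<forall>i\<in>supp x. t $ i = - \<delta> $ i * (y $ i)\<^sup>2 / (x $ i)\<^sup>2 - \<mu> \<bullet> column i D + h $ i) \<and>
     (\<exists>(\<beta> :: 'n \<Rightarrow> real) (\<Psi> :: 'n \<Rightarrow> real) (\<psi> :: 'k \<Rightarrow> real).
        (\<forall>i\<in>- supp x.
           (\<Sum>j\<in>- supp x. ((if i = j then \<delta> $ i else 0)
                + (\<Sum>k\<in>idx0 L x. 1 / real (nnz L k) * (L $ i $ k * L $ j $ k))) * \<beta> j)
           = 2 * cut_residual R g A C x y l \<mu> i) \<and>
        (\<forall>i\<in>- supp x. \<Psi> i = 1 / 2 * \<beta> i) \<and>
        (\<forall>k\<in>idx0 L x. \<psi> k = 1 / (2 * real (nnz L k)) * (\<Sum>j\<in>- supp x. L $ j $ k * \<beta> j)) \<and>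
        (\<forall>i\<in>- supp x. t $ i = - (\<delta> $ i / 4) * (\<Psi> i)\<^sup>2
           - 1 / 4 * (\<Sum>k | k \<in> idx0 L x \<and> L $ i $ k \<noteq> 0. (\<psi> k)\<^sup>2)
           - \<mu> \<bullet> column i D + h $ i))"

end

theory Submission
  imports Defs
begin

text \<open>
  At a binary \<open>x\<close> the two functions agree for every \<open>y\<close>: if \<open>y\<close> violates \<open>y $ i * (1 - x $ i) = 0\<close> both
  are \<open>\<infinity>\<close>, and otherwise each maximum is attained by its first entry, since the denominator is
  either at least \<open>1\<close>, or \<open>0\<close> with a vanishing numerator.

  For the cuts put \<open>w = \<beta> / 2\<close> and let \<open>M\<close> be the matrix of the linear system, so \<open>M w = r\<close>. The
  quadratic part of \<open>\<Sum> t'\<close> is \<open>- w \<bullet> M w / 4\<close> and that of \<open>\<Sum> t\<close> is \<open>- (\<Sum> r\<^sub>i\<^sup>2 / \<delta>\<^sub>i) / 4\<close>. Since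
  \<open>M \<ge> diag \<delta>\<close>, one has \<open>w \<bullet> M w = 2 w \<bullet> r - w \<bullet> M w \<le> \<Sum> (2 w\<^sub>i r\<^sub>i - \<delta>\<^sub>i w\<^sub>i\<^sup>2) \<le> \<Sum> r\<^sub>i\<^sup>2 / \<delta>\<^sub>i\<close>.
\<close>

lemma outer_mult_vec: "outer u v *v y = (v \<bullet> y) *\<^sub>R u"
  by (simp add: outer_def vec_eq_iff matrix_vector_mult_def inner_vec_def sum_distrib_left mult_ac)

lemma sum_matrix_vec_mult: "(\<Sum>i\<in>I. M i) *v y = (\<Sum>i\<in>I. M i *v (y :: real^'n))"
  by (induction I rule: infinite_finite_induct) (simp_all add: matrix_vector_mult_add_rdistrib)

text \<open>Each rank-one term contributes a square. This splits the quadratic form of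
  \<open>R\<close> into the summands that \<open>f_persp_ro\<close> treats separately.\<close>

lemma quadratic_form_sum_outer:
  fixes y :: "real^'n"
  shows "y \<bullet> (((\<Sum>i\<in>I. outer (u i) (u i)) + N) *v y) = (\<Sum>i\<in>I. (u i \<bullet> y)\<^sup>2) + y \<bullet> (N *v y)"
  by (simp add: matrix_vector_mult_add_rdistrib sum_matrix_vec_mult outer_mult_vec inner_add_right
      inner_sum_right power2_eq_square inner_commute)

text \<open>Covers the denominators in \<open>f_persp_ro\<close>: for binary entries no value
  strictly between \<open>0\<close> and \<open>1\<close> occurs.\<close>

lemma sum_binary_cases:
  fixes x :: "'a \<Rightarrow> real"
  assumes "finite J" "\<forall>j\<in>J. x j = 0 \<or> x j = 1"
  obtains "\<forall>j\<in>J. x j = 0" "sum x J = 0" | "1 \<le> sum x J"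
proof (cases "\<forall>j\<in>J. x j = 0")
  case True
  then show ?thesis using that(1) by simp
next
  case False
  then obtain j where j: "j \<in> J" "x j = 1" using assms(2) by blast
  have "0 \<le> x i" if "i \<in> J" for i
    using assms(2) that by force
  then have "x j \<le> sum x J"
    using assms(1) j(1) by (intro member_le_sum) auto
  then show ?thesis using that(2) j(2) by simp
qed

lemma max_persp_binary:
  fixes u x y :: "real^'n"
  assumes "\<forall>i. x $ i = 0 \<or> x $ i = 1" and "\<forall>i. x $ i = 0 \<longrightarrow> y $ i = 0"
  shows "max (ereal ((u \<bullet> y)\<^sup>2)) (persp 1 (u \<bullet> y) (\<Sum>j | u $ j \<noteq> 0. x $ j)) = ereal ((u \<bullet> y)\<^sup>2)"
proof (rule sum_binary_cases[of "{j. u $ j \<noteq> 0}" "($) x"])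
  assume x0: "\<forall>j\<in>{j. u $ j \<noteq> 0}. x $ j = 0" and s0: "(\<Sum>j | u $ j \<noteq> 0. x $ j) = 0"
  have "u \<bullet> y = 0"
    unfolding inner_vec_def using x0 assms(2) by (intro sum.neutral) auto
  then show ?thesis using s0 by (simp add: persp_def)
next
  assume s1: "1 \<le> (\<Sum>j | u $ j \<noteq> 0. x $ j)"
  then have "(u \<bullet> y)\<^sup>2 / (\<Sum>j | u $ j \<noteq> 0. x $ j) \<le> (u \<bullet> y)\<^sup>2 / 1"
    by (intro divide_left_mono) auto
  then show ?thesis using s1 by (simp add: persp_def)
qed (use assms(1) in auto)

lemma f_persp_ro_binary_eq:
  fixes L :: "real^'k^'n" and x y :: "real^'n"
  assumes bin: "\<forall>i. x $ i = 0 \<or> x $ i = 1"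
    and R: "R = (\<Sum>i\<in>UNIV. outer (column i L) (column i L)) + N"
  shows "f_persp R \<delta> g h A b C D x y = f_persp_ro L N \<delta> g h A b C D x y"
proof (cases "\<forall>i. x $ i = 0 \<longrightarrow> y $ i = 0")
  case True
  have "max (ereal ((column i L \<bullet> y)\<^sup>2)) (persp 1 (column i L \<bullet> y) (\<Sum>j | L $ j $ i \<noteq> 0. x $ j))
      = ereal ((column i L \<bullet> y)\<^sup>2)" for i
    using max_persp_binary[OF bin True, of "column i L"] by (simp add: column_def)
  then show ?thesis
    unfolding f_persp_def f_persp_ro_def R quadratic_form_sum_outer by simp
next
  case False
  then obtain i where "x $ i = 0" "y $ i \<noteq> 0" by blast
  \<comment> \<open>This holds even for \<open>\<delta> $ i = 0\<close>, as the coefficient sits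
    inside \<open>persp\<close>. The infinite sum is common to both functions and absorbs all other
    terms.\<close>
  then have "persp (\<delta> $ i) (y $ i) (x $ i) = \<infinity>" by (simp add: persp_def)
  then have "(\<Sum>i\<in>UNIV. persp (\<delta> $ i) (y $ i) (x $ i)) = \<infinity>"
    by (auto simp: sum_Pinfty)
  then show ?thesis by (simp add: f_persp_def f_persp_ro_def)
qed

text \<open>Completing the square. For \<open>d = 0\<close> both sides are \<open>0\<close>, the
  right one by the convention for division by zero.\<close>

lemma two_mult_diff_square_le:
  fixes d r w :: real
  assumes "0 \<le> d" and "d = 0 \<longrightarrow> r = 0"
  shows "2 * w * r - d * w\<^sup>2 \<le> r\<^sup>2 / d"
proof (cases "d = 0")
  case False
  have "0 \<le> (r - d * w)\<^sup>2 / d" using assms(1) by simp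
  also have "\<dots> = r\<^sup>2 / d - (2 * w * r - d * w\<^sup>2)"
    using False by (simp add: field_simps power2_eq_square)
  finally show ?thesis by simp
qed (use assms in simp)

text \<open>The matrix is a diagonal plus weighted rank-one terms. With the sum over
  \<open>k\<close> moved outermost, the double sum over \<open>i\<close> and \<open>j\<close>
  factors into a square.\<close>

lemma quadratic_form_diag_sum:
  fixes \<delta> w :: "'a \<Rightarrow> real"
  assumes "finite T"
  shows "(\<Sum>i\<in>T. w i * (\<Sum>j\<in>T. ((if i = j then \<delta> i else 0) + (\<Sum>k\<in>I. c k * (a i k * a j k))) * w j))
    = (\<Sum>i\<in>T. \<delta> i * (w i)\<^sup>2) + (\<Sum>k\<in>I. c k * (\<Sum>i\<in>T. a i k * w i)\<^sup>2)"
proof -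
  have "(\<Sum>i\<in>T. w i * (\<Sum>j\<in>T. (\<Sum>k\<in>I. c k * (a i k * a j k)) * w j))
      = (\<Sum>i\<in>T. \<Sum>j\<in>T. \<Sum>k\<in>I. c k * (a i k * w i) * (a j k * w j))"
    by (simp add: sum_distrib_left sum_distrib_right mult_ac)
  also have "\<dots> = (\<Sum>i\<in>T. \<Sum>k\<in>I. \<Sum>j\<in>T. c k * (a i k * w i) * (a j k * w j))"
    by (intro sum.cong refl sum.swap)
  also have "\<dots> = (\<Sum>k\<in>I. \<Sum>i\<in>T. \<Sum>j\<in>T. c k * (a i k * w i) * (a j k * w j))"
    by (rule sum.swap)
  also have "\<dots> = (\<Sum>k\<in>I. c k * (\<Sum>i\<in>T. a i k * w i)\<^sup>2)"
    unfolding power2_eq_square sum_product by (simp add: sum_distrib_left mult.assoc)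
  finally have low: "(\<Sum>i\<in>T. w i * (\<Sum>j\<in>T. (\<Sum>k\<in>I. c k * (a i k * a j k)) * w j))
      = (\<Sum>k\<in>I. c k * (\<Sum>i\<in>T. a i k * w i)\<^sup>2)" .
  have "(\<Sum>j\<in>T. (if i = j then \<delta> i else 0) * w j) = \<delta> i * w i" if "i \<in> T" for i
    using assms that by (simp add: if_distrib[of "\<lambda>z. z * _"] cong: if_cong)
  then have "(\<Sum>i\<in>T. w i * (\<Sum>j\<in>T. (if i = j then \<delta> i else 0) * w j)) = (\<Sum>i\<in>T. \<delta> i * (w i)\<^sup>2)"
    by (intro sum.cong) (auto simp: power2_eq_square)
  with low show ?thesis
    by (simp add: distrib_right sum.distrib distrib_left)
qed

text \<open>A vanishing sum of nonnegative terms has only zero terms.\<close>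

lemma idx0_support:
  assumes "\<forall>i. 0 \<le> x $ i" and "k \<in> idx0 L x"
  shows "{i. L $ i $ k \<noteq> 0} \<subseteq> - supp x"
proof -
  have "\<forall>l\<in>{l. L $ l $ k \<noteq> 0}. x $ l = 0"
    using assms sum_nonneg_eq_0_iff[of "{l. L $ l $ k \<noteq> 0}" "($) x"] by (simp add: idx0_def)
  then show ?thesis by (auto simp: supp_def)
qed

text \<open>Double counting: \<open>k\<close> occurs once for each nonzero entry of its column, and
  by \<open>idx0_support\<close> all of these lie outside \<open>supp x\<close>.\<close>

lemma sum_idx0_incidence:
  fixes L :: "real^'k^'n"
  assumes "\<forall>i. 0 \<le> x $ i"
  shows "(\<Sum>i\<in>- supp x. \<Sum>k | k \<in> idx0 L x \<and> L $ i $ k \<noteq> 0. f k)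
    = (\<Sum>k\<in>idx0 L x. real (nnz L k) * f k)"
proof -
  have "(\<Sum>i\<in>- supp x. \<Sum>k | k \<in> idx0 L x \<and> L $ i $ k \<noteq> 0. f k)
      = (\<Sum>k\<in>idx0 L x. \<Sum>i | i \<in> - supp x \<and> L $ i $ k \<noteq> 0. f k)"
    by (rule sum.swap_restrict) auto
  also have "\<dots> = (\<Sum>k\<in>idx0 L x. real (nnz L k) * f k)"
  proof (rule sum.cong[OF refl])
    fix k assume "k \<in> idx0 L x"
    then have "{i. i \<in> - supp x \<and> L $ i $ k \<noteq> 0} = {i. L $ i $ k \<noteq> 0}"
      using idx0_support[OF assms] by blast
    then show "(\<Sum>i | i \<in> - supp x \<and> L $ i $ k \<noteq> 0. f k) = real (nnz L k) * f k"
      by (simp add: nnz_def)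
  qed
  finally show ?thesis .
qed

lemma sum_cut_persp_le_cut_persp_ro:
  fixes L :: "real^'k^'n"
  assumes xnn: "\<forall>i. 0 \<le> x $ i" and \<delta>nn: "\<forall>i. 0 \<le> \<delta> $ i"
    and "cut_persp R \<delta> g h A C D x y l \<mu> t"
    and "cut_persp_ro L R \<delta> g h A C D x y l \<mu> t'"
  shows "(\<Sum>i\<in>- supp x. t $ i) \<le> (\<Sum>i\<in>- supp x. t' $ i)"
proof -
  define T where "T = - supp x"
  define r where "r = cut_residual R g A C x y l \<mu>"
  define e where "e i = - \<mu> \<bullet> column i D + h $ i" for i
  obtain \<Psi> where 1: "\<And>i. i \<in> T \<Longrightarrow> \<delta> $ i = 0 \<longrightarrow> r i = 0"
      "\<And>i. i \<in> T \<Longrightarrow> \<Psi> i = 1 / \<delta> $ i * r i"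
      "\<And>i. i \<in> T \<Longrightarrow> t $ i = - (\<delta> $ i / 4) * (\<Psi> i)\<^sup>2 - \<mu> \<bullet> column i D + h $ i"
    using assms(3) unfolding cut_persp_def T_def r_def by blast
  obtain \<beta> \<Psi>' \<psi> where 2:
      "\<And>i. i \<in> T \<Longrightarrow> (\<Sum>j\<in>T. ((if i = j then \<delta> $ i else 0)
          + (\<Sum>k\<in>idx0 L x. 1 / real (nnz L k) * (L $ i $ k * L $ j $ k))) * \<beta> j) = 2 * r i"
      "\<And>i. i \<in> T \<Longrightarrow> \<Psi>' i = 1 / 2 * \<beta> i"
      "\<And>k. k \<in> idx0 L x \<Longrightarrow> \<psi> k = 1 / (2 * real (nnz L k)) * (\<Sum>j\<in>T. L $ j $ k * \<beta> j)"
      "\<And>i. i \<in> T \<Longrightarrow> t' $ i = - (\<delta> $ i / 4) * (\<Psi>' i)\<^sup>2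
          - 1 / 4 * (\<Sum>k | k \<in> idx0 L x \<and> L $ i $ k \<noteq> 0. (\<psi> k)\<^sup>2) - \<mu> \<bullet> column i D + h $ i"
    using assms(4) unfolding cut_persp_ro_def T_def r_def by blast
  define w where "w i = \<beta> i / 2" for i
  define p where "p = (\<Sum>k\<in>idx0 L x. 1 / real (nnz L k) * (\<Sum>i\<in>T. L $ i $ k * w i)\<^sup>2)"
  define q where "q = (\<Sum>i\<in>T. \<delta> $ i * (w i)\<^sup>2)"
  \<comment> \<open>If \<open>\<delta> $ i = 0\<close>, then \<open>r i = 0\<close> and both
    quadratic terms vanish.\<close>
  have "t $ i = e i - (r i)\<^sup>2 / \<delta> $ i / 4" if "i \<in> T" for i
    using 1(1)[OF that]
    by (cases "\<delta> $ i = 0") (auto simp: e_def 1(2,3)[OF that] power2_eq_square)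
  then have t: "(\<Sum>i\<in>T. t $ i) = (\<Sum>i\<in>T. e i) - (\<Sum>i\<in>T. (r i)\<^sup>2 / \<delta> $ i) / 4"
    by (simp add: sum_subtractf sum_divide_distrib)
  \<comment> \<open>The multiplicity from the double counting cancels one of the two factors
    \<open>1 / nnz L k\<close> in the square of \<open>\<psi> k\<close>. For a zero column both
    sides are \<open>0\<close>.\<close>
  have "real (nnz L k) * (\<psi> k)\<^sup>2 = 1 / real (nnz L k) * (\<Sum>i\<in>T. L $ i $ k * w i)\<^sup>2"
    if "k \<in> idx0 L x" for k
  proof -
    have "(\<Sum>j\<in>T. L $ j $ k * \<beta> j) = 2 * (\<Sum>i\<in>T. L $ i $ k * w i)"
      by (simp add: w_def sum_distrib_left)
    then show ?thesis using 2(3)[OF that] by (simp add: power2_eq_square)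
  qed
  then have p: "(\<Sum>i\<in>T. \<Sum>k | k \<in> idx0 L x \<and> L $ i $ k \<noteq> 0. (\<psi> k)\<^sup>2) = p"
    unfolding T_def sum_idx0_incidence[OF xnn] p_def by (intro sum.cong) auto
  have "t' $ i = e i - (\<delta> $ i * (w i)\<^sup>2) / 4
      - (\<Sum>k | k \<in> idx0 L x \<and> L $ i $ k \<noteq> 0. (\<psi> k)\<^sup>2) / 4" if "i \<in> T" for i
    by (simp add: e_def w_def 2(2,4)[OF that])
  then have t': "(\<Sum>i\<in>T. t' $ i) = (\<Sum>i\<in>T. e i) - q / 4 - p / 4"
    by (simp add: sum_subtractf sum_divide_distrib[symmetric] p q_def)
  have "(\<Sum>j\<in>T. ((if i = j then \<delta> $ i else 0)
          + (\<Sum>k\<in>idx0 L x. 1 / real (nnz L k) * (L $ i $ k * L $ j $ k))) * w j) = r i"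
    if "i \<in> T" for i
    using 2(1)[OF that] by (simp add: w_def sum_divide_distrib[symmetric])
  \<comment> \<open>Pair the linear system, halved so that its right side is \<open>r\<close>, with
    \<open>w\<close>.\<close>
  then have "(\<Sum>i\<in>T. w i * r i) = q + p"
    unfolding q_def p_def quadratic_form_diag_sum[OF finite, symmetric] by simp
  moreover have "0 \<le> p"
    unfolding p_def by (intro sum_nonneg) simp
  \<comment> \<open>By the pairing identity the left side is \<open>q + 2 * p\<close>, hence at
    least \<open>q + p\<close>, the amount to be bounded.\<close>
  moreover have "2 * (\<Sum>i\<in>T. w i * r i) - q \<le> (\<Sum>i\<in>T. (r i)\<^sup>2 / \<delta> $ i)"
  proof -
    have "(\<Sum>i\<in>T. 2 * w i * r i - \<delta> $ i * (w i)\<^sup>2) \<le> (\<Sum>i\<in>T. (r i)\<^sup>2 / \<delta> $ i)"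
      using \<delta>nn 1(1) by (intro sum_mono two_mult_diff_square_le) auto
    then show ?thesis
      by (simp add: sum_subtractf q_def sum_distrib_left mult.assoc)
  qed
  ultimately show ?thesis
    using t t' unfolding T_def by linarith
qed

theorem mainTheorem4:
  fixes Q R N :: "real^'n^'n"
    and L :: "real^'k^'n"
    and \<delta> g h x :: "real^'n"
    and A :: "real^'n^'m1" and b :: "real^'m1"
    and C D :: "real^'n^'m2"
    and X :: "(real^'n) set"
  assumes "pos_def Q"
    and "X \<subseteq> {x. \<forall>i. x $ i \<in> {0, 1}}"
    and "\<exists>x' y'. x' \<in> X \<and> A *v y' \<le> b \<and> C *v y' \<le> D *v x' \<and> (\<forall>i. y' $ i * (1 - x' $ i) = 0)"
    and "CARD('k) \<le> CARD('n)"
    and "Q = (\<Sum>i\<in>UNIV. outer (column i L) (column i L)) + diag \<delta> + N"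
    and "\<forall>i. 0 \<le> \<delta> $ i"
    and "pos_semidef N"
    and "R = (\<Sum>i\<in>UNIV. outer (column i L) (column i L)) + N"
    and "x \<in> X"
  shows "f_bar (f_persp R \<delta> g h A b C D) x = f_bar (f_persp_ro L N \<delta> g h A b C D) x \<and>
    (\<forall>y l \<mu> t t'. primal_dual_opt R \<delta> g A b C D x y l \<mu> \<longrightarrow>
       cut_persp R \<delta> g h A C D x y l \<mu> t \<longrightarrow>
       cut_persp_ro L R \<delta> g h A C D x y l \<mu> t' \<longrightarrow>
       (\<Sum>i | x $ i = 0. t' $ i) \<ge> (\<Sum>i | x $ i = 0. t $ i))"
proof -
  have bin: "\<forall>i. x $ i = 0 \<or> x $ i = 1"
    using assms(2,9) by auto
  then have xnn: "\<forall>i. 0 \<le> x $ i"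
    by (metis order_refl zero_le_one)
  have "{i. x $ i = 0} = - supp x"
    using bin by (force simp: supp_def)
  \<comment> \<open>The functions agree at every \<open>y\<close>, so their infima agree without any
    discussion of minimizers.\<close>
  moreover have "f_persp R \<delta> g h A b C D x = f_persp_ro L N \<delta> g h A b C D x"
    by (rule ext) (rule f_persp_ro_binary_eq[OF bin assms(8)])
  ultimately show ?thesis
    using sum_cut_persp_le_cut_persp_ro[OF xnn assms(6)]
    by (auto simp: f_bar_def)
qed

end
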